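(* Let $G$ be a finite group with exponent $q$. Then the power graph $P(G)$ is a friendship graph if and only if $q=3$.
   Context: The power graph $P(G)$ of a finite group $G$ is the simple graph with vertex set $G$ in which two distinct vertices $u,v$ are adjacent if and only if $u\in\langle v\rangle$ or $v\in\langle u\rangle$. The exponent of $G$ is the smallest positive integer $q$ such that $g^q=e$ for all $g\in G$. The friendship graph $F_n$ ($n\ge 1$) is $K_1\vee(nK_2)$: a single vertex joined to all vertices of $n$ disjoint copies of $K_2$. A graph is a friendship graph if it is isomorphic to $F_n$ for some $n\geq 1$. *)

theory Defs
  imports "HOL-Algebra.Generated_Groups" "Graph_Theory.Graph_Theory"
begin

text \<open>
  Simple graphs are represented as in \<^theory>\<open>Graph_Theory.Pair_Digraph\<close>: an undirected edge
  between \<open>u\<close> and \<open>v\<close> is the pair of opposite arcs \<open>(u, v)\<close> and \<open>(v, u)\<close>. Isomorphism is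
  \<^const>\<open>digraph_iso\<close>.
\<close>

definition group_exponent :: "('a, 'b) monoid_scheme \<Rightarrow> nat" where
  "group_exponent G = (LEAST q. 0 < q \<and> (\<forall>g \<in> carrier G. g [^]\<^bsub>G\<^esub> q = \<one>\<^bsub>G\<^esub>))"

definition power_graph :: "('a, 'b) monoid_scheme \<Rightarrow> 'a pair_pre_digraph" where
  "power_graph G =
    \<lparr> pverts = carrier G,
      parcs = {(u, v). u \<in> carrier G \<and> v \<in> carrier G \<and> u \<noteq> v \<and>
                 (u \<in> generate G {v} \<or> v \<in> generate G {u})} \<rparr>"

definition complete_graph :: "nat \<Rightarrow> nat pair_pre_digraph" where
  "complete_graph m =
    \<lparr> pverts = {..<m}, parcs = {(i, j). i < m \<and> j < m \<and> i \<noteq> j} \<rparr>"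

definition disjoint_copies :: "nat \<Rightarrow> 'a pair_pre_digraph \<Rightarrow> (nat \<times> 'a) pair_pre_digraph" where
  "disjoint_copies n H =
    \<lparr> pverts = {..<n} \<times> pverts H,
      parcs = {((i, u), (j, v)). i < n \<and> i = j \<and> (u, v) \<in> parcs H} \<rparr>"

definition graph_join :: "'a pair_pre_digraph \<Rightarrow> 'b pair_pre_digraph \<Rightarrow> ('a + 'b) pair_pre_digraph" where
  "graph_join G H =
    \<lparr> pverts = pverts G <+> pverts H,
      parcs = map_prod Inl Inl ` parcs G \<union> map_prod Inr Inr ` parcs H \<union>
              (Inl ` pverts G) \<times> (Inr ` pverts H) \<union> (Inr ` pverts H) \<times> (Inl ` pverts G) \<rparr>"

definition friendship_graph :: "nat \<Rightarrow> (nat + nat \<times> nat) pair_pre_digraph" where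
  "friendship_graph n = graph_join (complete_graph 1) (disjoint_copies n (complete_graph 2))"

definition is_friendship_graph :: "'a pair_pre_digraph \<Rightarrow> bool" where
  "is_friendship_graph P \<longleftrightarrow>
    (\<exists>n\<ge>1. digraph_iso (with_proj P) (with_proj (friendship_graph n)))"

lemma pair_graphI:
  assumes "finite (pverts P)" and "parcs P \<subseteq> pverts P \<times> pverts P"
    and "sym (parcs P)" and "irrefl (parcs P)"
  shows "pair_graph P"
proof
  show "finite (parcs P)"
    using assms(1,2) by (meson finite_SigmaI finite_subset)
  show "symmetric (with_proj P)"
    using assms(3) by (simp add: symmetric_def)
qed (use assms in \<open>auto simp: irrefl_def\<close>)

lemma pair_graph_power_graph:
  assumes "finite (carrier G)"
  shows "pair_graph (power_graph G)"
  using assms by (intro pair_graphI) (auto simp: power_graph_def sym_def irrefl_def)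

lemma complete_digraph_complete_graph: "complete_digraph m (with_proj (complete_graph m))"
  by (auto simp: complete_digraph_pair_def complete_graph_def)

lemma pair_graph_friendship_graph: "pair_graph (friendship_graph n)"
  by (intro pair_graphI)
    (auto simp: friendship_graph_def graph_join_def disjoint_copies_def complete_graph_def
       sym_def irrefl_def)

end

theory Submission
  imports Defs "HOL-Algebra.Multiplicative_Group" "HOL-Computational_Algebra.Primes"
begin

text \<open>
  In a friendship graph every vertex but the centre has exactly two neighbours, and the number of
  vertices is odd. In a power graph \<open>\<langle>g\<rangle>\<close> lies in the closed neighbourhood of \<open>g\<close>, and the identity
  is adjacent to every other vertex. So if the power graph of \<open>G\<close> is a friendship graph, either the
  identity is the centre, and then every cyclic subgroup has at most three elements, or the
  identity has only two neighbours, and then \<open>G\<close> itself has three elements. Either way elements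
  have order at most three; by Lagrange's theorem and the odd group order they do not have order
  two. This is \<open>pow_3_eq_one_if_friendship\<close>.

  Conversely, let \<open>G\<close> be nontrivial with \<open>g\<^sup>3 = \<one>\<close> for all \<open>g\<close>. Then \<open>\<langle>g\<rangle> = {\<one>, g, inv g}\<close>, so two non-identity
  elements are adjacent exactly if they are inverse to each other. Inversion has no fixed point
  besides the identity, so it splits the other vertices into pairs, which are the
  copies of \<open>K\<^sub>2\<close>; the identity is the centre (\<open>is_friendship_graphI\<close>).
\<close>

section \<open>Friendship graphs\<close>

text \<open>
  For arcs that are pairs of vertices the arc map of an isomorphism is forced by the vertex map.
\<close>
lemma digraph_iso_with_projD:
  assumes "digraph_iso (with_proj P) (with_proj Q)"
  obtains f where "inj_on f (pverts P)" "pverts Q = f ` pverts P" "parcs Q = map_prod f f ` parcs P"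
proof -
  from assms obtain h where h: "pre_digraph.digraph_isomorphism (with_proj P) h"
    and Q: "with_proj Q = app_iso h (with_proj P)"
    unfolding digraph_iso_def by blast
  have V: "pverts Q = iso_verts h ` pverts P" and A: "parcs Q = iso_arcs h ` parcs P"
    and ends: "iso_tail h = fst" "iso_head h = snd"
    using Q by (auto simp: with_proj_def app_iso_def)
  have "iso_arcs h a = map_prod (iso_verts h) (iso_verts h) a" if "a \<in> parcs P" for a
    using h that ends unfolding pre_digraph.digraph_isomorphism_def
    by (auto intro!: prod_eqI)
  then have "parcs Q = map_prod (iso_verts h) (iso_verts h) ` parcs P"
    unfolding A by (intro image_cong) auto
  moreover have "inj_on (iso_verts h) (pverts P)"
    using h unfolding pre_digraph.digraph_isomorphism_def by auto
  ultimately show thesis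
    using V that by blast
qed

lemma digraph_iso_with_projI:
  assumes wf: "parcs P \<subseteq> pverts P \<times> pverts P"
    and inj: "inj_on f (pverts P)"
    and Q: "pverts Q = f ` pverts P" "parcs Q = map_prod f f ` parcs P"
  shows "digraph_iso (with_proj P) (with_proj Q)"
proof -
  define h where "h = \<lparr>iso_verts = f, iso_arcs = map_prod f f, iso_head = snd, iso_tail = fst\<rparr>"
  have "wf_digraph (with_proj P)"
    using wf by unfold_locales auto
  moreover have "inj_on (map_prod f f) (parcs P)"
    using inj_on_subset[OF map_prod_inj_on[OF inj inj] wf] .
  ultimately have "pre_digraph.digraph_isomorphism (with_proj P) h"
    using inj unfolding pre_digraph.digraph_isomorphism_def by (auto simp: h_def)
  moreover have "with_proj Q = app_iso h (with_proj P)"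
    using Q by (simp add: with_proj_def app_iso_def h_def)
  ultimately show ?thesis
    unfolding digraph_iso_def by blast
qed

lemma pverts_friendship_graph:
  "pverts (friendship_graph n) = insert (Inl 0) (Inr ` ({..<n} \<times> {..<2}))"
  by (auto simp: friendship_graph_def graph_join_def disjoint_copies_def complete_graph_def)

lemma parcs_friendship_graph:
  "(x, y) \<in> parcs (friendship_graph n) \<longleftrightarrow>
    x \<in> pverts (friendship_graph n) \<and> y \<in> pverts (friendship_graph n) \<and> x \<noteq> y \<and>
    (x = Inl 0 \<or> y = Inl 0 \<or> fst (projr x) = fst (projr y))"
  by (auto simp: friendship_graph_def graph_join_def disjoint_copies_def complete_graph_def image_iff)

lemma card_pverts_friendship_graph: "card (pverts (friendship_graph n)) = 2 * n + 1"
  by (simp add: pverts_friendship_graph card_insert_if image_iff card_image)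

lemma card_neighbours_friendship_graph:
  assumes "x \<in> pverts (friendship_graph n)" "x \<noteq> Inl 0"
  shows "card {y. (x, y) \<in> parcs (friendship_graph n)} = 2"
proof -
  obtain i b where x: "x = Inr (i, b)" "i < n" "b = 0 \<or> b = 1"
    using assms by (auto simp: pverts_friendship_graph less_2_cases_iff)
  have "{y. (x, y) \<in> parcs (friendship_graph n)} = {Inl 0, Inr (i, 1 - b)}"
    using x by (auto simp: parcs_friendship_graph pverts_friendship_graph less_2_cases_iff)
  then show ?thesis
    by simp
qed

lemma is_friendship_graphD:
  assumes P: "is_friendship_graph P" and wf: "parcs P \<subseteq> pverts P \<times> pverts P"
  obtains c where "c \<in> pverts P" "odd (card (pverts P))" "card (pverts P) > 1"
    "\<And>v. v \<in> pverts P \<Longrightarrow> v \<noteq> c \<Longrightarrow> card {w. (v, w) \<in> parcs P} = 2"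
proof -
  from P obtain n where n: "n \<ge> 1"
    and iso: "digraph_iso (with_proj P) (with_proj (friendship_graph n))"
    unfolding is_friendship_graph_def by blast
  from iso obtain f where inj: "inj_on f (pverts P)"
    and V: "pverts (friendship_graph n) = f ` pverts P"
    and A: "parcs (friendship_graph n) = map_prod f f ` parcs P"
    by (rule digraph_iso_with_projD)
  have card: "card (pverts P) = 2 * n + 1"
    using card_image[OF inj] card_pverts_friendship_graph[of n] V by simp
  have "Inl 0 \<in> pverts (friendship_graph n)"
    by (simp add: pverts_friendship_graph)
  then obtain c where c: "c \<in> pverts P" "f c = Inl 0"
    using V by auto
  have "card {w. (v, w) \<in> parcs P} = 2" if v: "v \<in> pverts P" "v \<noteq> c" for v
  proof -
    have "f v \<noteq> Inl 0"
      using v c inj by (metis inj_onD)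
    then have "card {y. (f v, y) \<in> parcs (friendship_graph n)} = 2"
      using card_neighbours_friendship_graph[of "f v" n] v V by auto
    moreover have "{y. (f v, y) \<in> parcs (friendship_graph n)} = f ` {w. (v, w) \<in> parcs P}"
      using v wf inj unfolding A by (fastforce dest: inj_onD)
    moreover have "inj_on f {w. (v, w) \<in> parcs P}"
      by (rule inj_on_subset[OF inj]) (use wf in auto)
    ultimately show ?thesis
      by (simp add: card_image)
  qed
  then show thesis
    using that c(1) card n by simp
qed

text \<open>
  The orbits \<open>{u, \<sigma> u}\<close> are numbered, and in each orbit a chosen representative gets the
  second coordinate \<open>0\<close> and the other element \<open>1\<close>.
\<close>
lemma fixpoint_free_involution_pairing:
  assumes fin: "finite A" and \<sigma>: "\<And>u. u \<in> A \<Longrightarrow> \<sigma> u \<in> A \<and> \<sigma> u \<noteq> u \<and> \<sigma> (\<sigma> u) = u"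
  obtains n and h :: "'a \<Rightarrow> nat \<times> nat"
  where "bij_betw h A ({..<n} \<times> {..<2})"
    "\<And>u v. u \<in> A \<Longrightarrow> v \<in> A \<Longrightarrow> fst (h u) = fst (h v) \<longleftrightarrow> v = u \<or> v = \<sigma> u"
proof -
  define orb where "orb u = {u, \<sigma> u}" for u
  define rep where "rep X = (SOME x. x \<in> X)" for X :: "'a set"
  have orb_eq: "orb u = orb v \<longleftrightarrow> v = u \<or> v = \<sigma> u" if "u \<in> A" "v \<in> A" for u v
    using \<sigma>[OF that(1)] \<sigma>[OF that(2)] unfolding orb_def by (auto simp: doubleton_eq_iff)
  have rep: "rep (orb u) = u \<or> rep (orb u) = \<sigma> u" for u
    using someI[of "\<lambda>x. x \<in> orb u" u] unfolding rep_def by (auto simp: orb_def)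
  obtain idx where idx: "bij_betw idx (orb ` A) {0..<card (orb ` A)}"
    using ex_bij_betw_finite_nat fin by blast
  define n where "n = card (orb ` A)"
  define h where "h u = (idx (orb u), if rep (orb u) = u then 0 else 1 :: nat)" for u
  have idx_eq: "idx (orb u) = idx (orb v) \<longleftrightarrow> v = u \<or> v = \<sigma> u" if "u \<in> A" "v \<in> A" for u v
    using orb_eq[OF that] idx that by (metis bij_betw_def inj_onD imageI)
  have "inj_on h A"
  proof (rule inj_onI)
    fix u v assume uv: "u \<in> A" "v \<in> A" "h u = h v"
    show "u = v"
    proof (rule ccontr)
      assume "u \<noteq> v"
      then have "v = \<sigma> u"
        using uv idx_eq[OF uv(1,2)] by (auto simp: h_def)
      moreover have "orb u = orb v"
        using orb_eq[OF uv(1,2)] calculation by simp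
      ultimately show False
        using uv(3) rep[of u] \<open>u \<noteq> v\<close> by (auto simp: h_def split: if_splits)
    qed
  qed
  moreover have "h ` A = {..<n} \<times> {..<2}"
  proof (intro subset_antisym subsetI)
    fix p assume "p \<in> h ` A"
    then show "p \<in> {..<n} \<times> {..<2}"
      using bij_betw_apply[OF idx] by (auto simp: h_def n_def)
  next
    fix p :: "nat \<times> nat" assume "p \<in> {..<n} \<times> {..<2}"
    then obtain i b where p: "p = (i, b)" "i < n" "b = 0 \<or> b = 1"
      by (auto simp: less_2_cases_iff)
    then obtain u where u: "u \<in> A" "i = idx (orb u)"
      using idx unfolding bij_betw_def n_def by (metis atLeast0LessThan imageE lessThan_iff)
    have o: "orb (\<sigma> u) = orb u"
      using \<sigma>[OF u(1)] by (auto simp: orb_def)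
    have "p = h u \<or> p = h (\<sigma> u)"
      using rep[of u] p u \<sigma>[OF u(1)] by (auto simp: h_def o)
    then show "p \<in> h ` A"
      using u \<sigma> by auto
  qed
  ultimately have "bij_betw h A ({..<n} \<times> {..<2})"
    by (simp add: bij_betw_def)
  then show thesis
    using that[of h n] idx_eq by (simp add: h_def)
qed

lemma is_friendship_graphI:
  assumes fin: "finite (pverts P)" and c: "c \<in> pverts P" "pverts P \<noteq> {c}"
    and \<sigma>: "\<And>u. u \<in> pverts P - {c} \<Longrightarrow> \<sigma> u \<in> pverts P - {c} \<and> \<sigma> u \<noteq> u \<and> \<sigma> (\<sigma> u) = u"
    and arcs: "parcs P = {(u, v). u \<in> pverts P \<and> v \<in> pverts P \<and> u \<noteq> v \<and>
      (u = c \<or> v = c \<or> v = \<sigma> u)}"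
  shows "is_friendship_graph P"
proof -
  obtain n and h :: "'a \<Rightarrow> nat \<times> nat"
    where bij: "bij_betw h (pverts P - {c}) ({..<n} \<times> {..<2})"
      and same: "\<And>u v. u \<in> pverts P - {c} \<Longrightarrow> v \<in> pverts P - {c} \<Longrightarrow>
        fst (h u) = fst (h v) \<longleftrightarrow> v = u \<or> v = \<sigma> u"
    by (rule fixpoint_free_involution_pairing[OF finite_Diff[OF fin] \<sigma>]) blast+
  have im: "h ` (pverts P - {c}) = {..<n} \<times> {..<2}" and inj: "inj_on h (pverts P - {c})"
    using bij by (auto simp: bij_betw_def)
  have "n \<ge> 1"
    using c im by (cases n) auto
  define f :: "'a \<Rightarrow> nat + nat \<times> nat" where "f v = (if v = c then Inl 0 else Inr (h v))" for v
  have f_inj: "inj_on f (pverts P)"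
    using inj by (auto simp: inj_on_def f_def)
  have "f ` pverts P = insert (f c) (f ` (pverts P - {c}))"
    using c by auto
  also have "f ` (pverts P - {c}) = Inr ` h ` (pverts P - {c})"
    by (auto simp: f_def)
  finally have V: "pverts (friendship_graph n) = f ` pverts P"
    by (simp add: pverts_friendship_graph im f_def)
  have adj: "(f u, f v) \<in> parcs (friendship_graph n) \<longleftrightarrow> (u, v) \<in> parcs P"
    if "u \<in> pverts P" "v \<in> pverts P" for u v
    using that same[of u v] inj_on_eq_iff[OF f_inj that]
    unfolding parcs_friendship_graph V arcs by (auto simp: f_def split: if_splits)
  have "parcs (friendship_graph n) = map_prod f f ` parcs P"
  proof (intro subset_antisym subrelI)
    fix x y assume xy: "(x, y) \<in> parcs (friendship_graph n)"
    then obtain u v where "x = f u" "y = f v" "u \<in> pverts P" "v \<in> pverts P"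
      using V unfolding parcs_friendship_graph by auto
    then show "(x, y) \<in> map_prod f f ` parcs P"
      using adj xy by force
  next
    fix x y assume "(x, y) \<in> map_prod f f ` parcs P"
    then show "(x, y) \<in> parcs (friendship_graph n)"
      using adj arcs by auto
  qed
  then have "digraph_iso (with_proj P) (with_proj (friendship_graph n))"
    using digraph_iso_with_projI[of P f] f_inj V arcs by auto
  then show ?thesis
    using \<open>n \<ge> 1\<close> by (auto simp: is_friendship_graph_def)
qed

section \<open>Groups of prime exponent\<close>

text \<open>
  The order of an element with \<open>g\<^sup>p = \<one>\<close> and \<open>g \<noteq> \<one>\<close> is \<open>p\<close> itself, so a single such element
  rules out every smaller exponent. Finiteness makes the minimum in the definition of the exponent
  range over a nonempty set.
\<close>
lemma (in group) group_exponent_prime_iff: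
  assumes fin: "finite (carrier G)" and p: "prime p"
  shows "group_exponent G = p \<longleftrightarrow> carrier G \<noteq> {\<one>} \<and> (\<forall>g \<in> carrier G. g [^] p = \<one>)"
proof
  assume e: "group_exponent G = p"
  let ?Q = "\<lambda>q::nat. 0 < q \<and> (\<forall>g \<in> carrier G. g [^] q = \<one>)"
  have "?Q (order G)"
    using fin by (simp add: order_gt_0_iff_finite pow_order_eq_1)
  then have "?Q p"
    using LeastI[of ?Q] e unfolding group_exponent_def by blast
  moreover have "carrier G \<noteq> {\<one>}"
  proof
    assume "carrier G = {\<one>}"
    then have "?Q 1"
      by simp
    then have "p \<le> 1"
      using Least_le[of ?Q 1] e unfolding group_exponent_def by simp
    then show False
      using prime_gt_1_nat[OF p] by simp
  qed
  ultimately show "carrier G \<noteq> {\<one>} \<and> (\<forall>g \<in> carrier G. g [^] p = \<one>)"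
    by blast
next
  assume nontriv: "carrier G \<noteq> {\<one>} \<and> (\<forall>g \<in> carrier G. g [^] p = \<one>)"
  then obtain g where g: "g \<in> carrier G" "g \<noteq> \<one>"
    using one_closed by blast
  have "ord g dvd p"
    using nontriv g pow_eq_id by blast
  then have "ord g = p"
    using p g ord_eq_1 unfolding prime_nat_iff by blast
  then show "group_exponent G = p"
    unfolding group_exponent_def
    using nontriv g p by (intro Least_equality) (auto simp: prime_gt_0_nat pow_eq_id intro: dvd_imp_le)
qed

lemma (in group) generate_if_pow_3_eq_one:
  assumes fin: "finite (carrier G)" and v: "v \<in> carrier G" "v [^] (3::nat) = \<one>"
  shows "generate G {v} = {\<one>, v, inv v}"
proof
  have sq: "v [^] (2::nat) = inv v"
    using v by (intro inv_equality[symmetric]) (simp_all add: numeral_2_eq_2 numeral_3_eq_3)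
  show "generate G {v} \<subseteq> {\<one>, v, inv v}"
  proof
    fix u assume "u \<in> generate G {v}"
    then obtain k :: nat where "u = v [^] k"
      using generate_pow_on_finite_carrier[OF fin v(1)] by blast
    also have "v [^] k = v [^] (3 * (k div 3) + k mod 3)"
      by simp
    also have "\<dots> = v [^] (k mod 3)"
      using v by (simp only: nat_pow_mult[symmetric] nat_pow_pow[symmetric]) simp
    finally have u: "u = v [^] (k mod 3)" .
    have "k mod 3 = 0 \<or> k mod 3 = 1 \<or> k mod 3 = 2"
      by arith
    then show "u \<in> {\<one>, v, inv v}"
      using u sq v by auto
  qed
  show "{\<one>, v, inv v} \<subseteq> generate G {v}"
    by (auto intro: generate.intros)
qed

section \<open>Power graphs that are friendship graphs\<close>

lemma parcs_power_graph_subset: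
  "parcs (power_graph G) \<subseteq> pverts (power_graph G) \<times> pverts (power_graph G)"
  by (auto simp: power_graph_def)

text \<open>
  Closed neighbourhoods of vertices other than the centre \<open>c\<close> have three elements, and \<open>\<langle>g\<rangle>\<close> lies
  in the closed neighbourhood of \<open>g\<close> as well as in that of \<open>\<one>\<close>. For \<open>g \<noteq> \<one>\<close> at least one of \<open>g\<close>
  and \<open>\<one>\<close> differs from \<open>c\<close>, so \<open>g\<close> has order at most three.
\<close>
lemma (in group) pow_3_eq_one_if_friendship:
  assumes fin: "finite (carrier G)" and P: "is_friendship_graph (power_graph G)"
    and g: "g \<in> carrier G"
  shows "g [^] (3::nat) = \<one>"
proof (cases "g = \<one>")
  case False
  have V: "pverts (power_graph G) = carrier G"
    by (simp add: power_graph_def)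
  obtain c where c: "c \<in> carrier G" and odd: "odd (order G)"
    and deg: "\<And>v. v \<in> carrier G \<Longrightarrow> v \<noteq> c \<Longrightarrow> card {w. (v, w) \<in> parcs (power_graph G)} = 2"
    by (rule is_friendship_graphD[OF P parcs_power_graph_subset, unfolded V, folded order_def]) blast
  have small: "card X \<le> 3"
    if v: "v \<in> carrier G" "v \<noteq> c"
      and X: "X \<subseteq> insert v {w. (v, w) \<in> parcs (power_graph G)}" for v X
  proof -
    let ?N = "{w. (v, w) \<in> parcs (power_graph G)}"
    have "finite ?N"
      by (rule card_ge_0_finite) (simp add: deg[OF v])
    then have "card X \<le> card (insert v ?N)"
      using X by (intro card_mono) auto
    also have "\<dots> \<le> 3"
      using \<open>finite ?N\<close> deg[OF v] by (simp add: card_insert_if)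
    finally show ?thesis .
  qed
  have gen_carrier: "generate G {g} \<subseteq> carrier G"
    using generate_in_carrier[of "{g}"] g by blast
  have "card (generate G {g}) \<le> 3"
  proof (cases "c = \<one>")
    case True
    show ?thesis
      by (rule small[of g]) (use g False True gen_carrier in \<open>auto simp: power_graph_def\<close>)
  next
    case False
    \<comment> \<open>The identity is adjacent to everything, so the whole group is its closed neighbourhood.\<close>
    show ?thesis
      by (rule small[of \<one>])
        (use False gen_carrier in \<open>auto simp: power_graph_def intro: generate.one\<close>)
  qed
  then have "ord g \<le> 3"
    using generate_pow_card[OF g] by simp
  moreover have "odd (ord g)"
    using ord_dvd_group_order[OF g] odd by (meson dvd_trans)
  moreover have "ord g \<noteq> 1"
    using ord_eq_1[OF g] False by simp
  ultimately have "ord g = 3"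
    by (auto simp: le_Suc_eq numeral_3_eq_3)
  then show ?thesis
    using pow_ord_eq_1[OF g] by simp
qed simp

lemma (in group) friendship_if_pow_3_eq_one:
  assumes fin: "finite (carrier G)" and nontriv: "carrier G \<noteq> {\<one>}"
    and cube: "\<And>g. g \<in> carrier G \<Longrightarrow> g [^] (3::nat) = \<one>"
  shows "is_friendship_graph (power_graph G)"
proof (rule is_friendship_graphI[where c = \<one> and \<sigma> = "\<lambda>g. inv g"])
  have V: "pverts (power_graph G) = carrier G"
    by (simp add: power_graph_def)
  show "finite (pverts (power_graph G))" "\<one> \<in> pverts (power_graph G)"
    "pverts (power_graph G) \<noteq> {\<one>}"
    using fin nontriv by (simp_all add: V)
  \<comment> \<open>A fixed point of inversion satisfies both \<open>g\<^sup>2 = \<one>\<close> and \<open>g\<^sup>3 = \<one>\<close>.\<close>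
  have "g = \<one>" if "g \<in> carrier G" "inv g = g" for g
  proof -
    have "g \<otimes> g = \<one>"
      using that by (metis l_inv)
    then show ?thesis
      using cube[OF that(1)] that(1) by (simp add: numeral_3_eq_3)
  qed
  then show "inv u \<in> pverts (power_graph G) - {\<one>} \<and> inv u \<noteq> u \<and> inv (inv u) = u"
    if "u \<in> pverts (power_graph G) - {\<one>}" for u
    using that by (auto simp: V)
  show "parcs (power_graph G) = {(u, v). u \<in> pverts (power_graph G) \<and>
      v \<in> pverts (power_graph G) \<and> u \<noteq> v \<and> (u = \<one> \<or> v = \<one> \<or> v = inv u)}"
    unfolding V by (auto simp: power_graph_def generate_if_pow_3_eq_one[OF fin _ cube])
qed

theorem theorem3p1:
  fixes G :: "('a, 'b) monoid_scheme"
  assumes "group G" and "finite (carrier G)"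
  shows "is_friendship_graph (power_graph G) \<longleftrightarrow> group_exponent G = 3"
proof -
  interpret group G by fact
  have exp: "group_exponent G = 3 \<longleftrightarrow>
      carrier G \<noteq> {\<one>\<^bsub>G\<^esub>} \<and> (\<forall>g \<in> carrier G. g [^]\<^bsub>G\<^esub> (3::nat) = \<one>\<^bsub>G\<^esub>)"
    using assms(2) by (intro group_exponent_prime_iff) simp_all
  show ?thesis
  proof
    assume P: "is_friendship_graph (power_graph G)"
    have "card (carrier G) > 1"
      by (rule is_friendship_graphD[OF P parcs_power_graph_subset]) (simp add: power_graph_def)
    then have "carrier G \<noteq> {\<one>\<^bsub>G\<^esub>}"
      by auto
    then show "group_exponent G = 3"
      unfolding exp using pow_3_eq_one_if_friendship[OF assms(2) P] by simp
  next
    assume "group_exponent G = 3"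
    then show "is_friendship_graph (power_graph G)"
      unfolding exp using friendship_if_pow_3_eq_one[OF assms(2)] by simp
  qed
qed

end
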